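(* Let $v$ and $q$ be positive integers, $v$ not a square. Let $m$ be an integer with $(m,q)=1$, and let $x=m/q+\sqrt v$. Put $q_1'=2$ if $q$ is even, and $q_1'=1$ otherwise. Then $x$ has a self-inverse period if, and only if, there is a pair $(r,c)\in\mathbb{Z}^2$ such that $r^2-c^2v=\pm 1$ (i.e. $r^2-c^2v\in\{1,-1\}$) and $(c,q^2)=qq_1'$.
   Context: $(a,b)$ denotes the (positive) greatest common divisor of the integers $a,b$; in particular $(0,b)=|b|$. A real quadratic irrational $x$ is said to have a self-inverse period if its regular continued fraction expansion can be written with a period $[b_1,\ldots,b_k]$ and also with the period $[b_k,\ldots,b_1]$; that is, $x=[a_0,\ldots,a_{j-1},[b_1,\ldots,b_k]]$ and also $x=[c_0,\ldots,c_{l-1},[b_k,\ldots,b_1]]$, where the inner bracket is the period, repeated indefinitely, and the pre-periods may be empty. *)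

theory Defs
  imports Complex_Main "HOL-Library.Stream"
begin

definition quadratic_irrational :: "real \<Rightarrow> bool" where
  "quadratic_irrational x \<longleftrightarrow>
     x \<notin> \<rat> \<and>
     (\<exists>a b c :: int. a \<noteq> 0 \<and> of_int a * x\<^sup>2 + of_int b * x + of_int c = 0)"

(* The stream of partial quotients produced by the continued fraction algorithm.
   It is the regular continued fraction expansion of x only if x is irrational:
   for rational x the algorithm reaches 1 / 0 = 0, and the stream ends in zeros. *)
definition cf_expansion :: "real \<Rightarrow> int stream" where
  "cf_expansion x = smap floor (siterate (\<lambda>y. 1 / frac y) x)"

(* The pre-period as may be empty, and bs need not be the shortest period. *)
definition has_cf_period :: "real \<Rightarrow> int list \<Rightarrow> bool" where
  "has_cf_period x bs \<longleftrightarrow> bs \<noteq> [] \<and> (\<exists>as. cf_expansion x = as @- cycle bs)"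

definition self_inverse_period :: "real \<Rightarrow> bool" where
  "self_inverse_period x \<longleftrightarrow>
     quadratic_irrational x \<and> (\<exists>bs. has_cf_period x bs \<and> has_cf_period x (rev bs))"

end

theory Submission
  imports Defs
begin

text \<open>
  Write \<open>x'\<close> for the conjugate \<open>m/q - sqrt v\<close> of \<open>x\<close>. The proof passes through the
  condition that \<open>x'\<close> is the image of \<open>x\<close> under an integral Moebius transformation of
  determinant \<open>1\<close> or \<open>-1\<close>; briefly, \<open>x'\<close> and \<open>x\<close> are equivalent.

  Self-inverse periods and equivalence. Two irrational numbers are equivalent if and only if
  their continued fractions have a common tail (Serret). The complete quotients of a quadratic
  irrational are eventually reduced, that is \<open>y > 1\<close> and \<open>-1 < y' < 0\<close>, and they are
  eventually periodic (Lagrange). If \<open>y\<close> has the purely periodic expansion \<open>[b1,...,bk]\<close>, then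
  \<open>-1/y'\<close> has the purely periodic expansion \<open>[bk,...,b1]\<close> (Galois; this is
  \<open>cf_expansion_uminus_inverse_conjugate\<close>). As \<open>-1/y'\<close> is equivalent to \<open>y'\<close>, and \<open>y'\<close> to
  \<open>x'\<close> when \<open>y\<close> is a complete quotient of \<open>x\<close>, the reversed period occurs in the expansion of
  \<open>x\<close> exactly if \<open>x'\<close> is equivalent to \<open>x\<close>
  (\<open>self_inverse_period_iff_moebius_equiv_conjugate\<close>).

  Equivalence and Pell equations. Comparing coordinates with respect to \<open>1, sqrt v\<close> shows that
  a matrix with entries \<open>a, b, c, d\<close> that maps \<open>x\<close> to \<open>x'\<close> has \<open>a = -d\<close>. Its
  determinant is then \<open>-(r^2 - c^2 v)\<close> with \<open>r = d + c m/q\<close>, so \<open>r\<close> is an integer and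
  \<open>q\<close> divides \<open>c\<close>; integrality of \<open>b\<close> amounts to the congruence
  \<open>2 r = (c/q) m (mod q)\<close> (\<open>moebius_equiv_conjugate_iff_pell\<close>). The congruence forces
  \<open>gcd (c/q) q\<close> to be \<open>1\<close> or \<open>2\<close> according to the parity of \<open>q\<close>. Conversely, if
  \<open>gcd (c/q) q\<close> has this value, some power of \<open>r + c sqrt v\<close> satisfies the congruence: the
  \<open>n\<close>-th power has coordinates congruent to \<open>r^n\<close> and \<open>n r^(n-1) c\<close>, and \<open>n\<close> can be
  chosen such that \<open>2 r = n (c/q) m (mod q)\<close> (\<open>pell_congruence_solvable\<close>).
\<close>

section \<open>Complete quotients\<close>

definition cf_step :: "real \<Rightarrow> real" where
  "cf_step x = 1 / frac x"

definition complete_quotient :: "real \<Rightarrow> nat \<Rightarrow> real" where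
  "complete_quotient x n = (cf_step ^^ n) x"

lemma complete_quotient_0 [simp]: "complete_quotient x 0 = x"
  by (simp add: complete_quotient_def)

lemma complete_quotient_Suc: "complete_quotient x (Suc n) = cf_step (complete_quotient x n)"
  by (simp add: complete_quotient_def)

lemma complete_quotient_add:
  "complete_quotient x (m + n) = complete_quotient (complete_quotient x m) n"
  unfolding complete_quotient_def by (subst add.commute) (simp add: funpow_add)

lemma cf_expansion_snth: "cf_expansion x !! n = \<lfloor>complete_quotient x n\<rfloor>"
  by (simp add: cf_expansion_def complete_quotient_def cf_step_def[abs_def])

lemma sdrop_cf_expansion: "sdrop n (cf_expansion x) = cf_expansion (complete_quotient x n)"
  by (simp add: cf_expansion_def complete_quotient_def cf_step_def[abs_def])

lemma stake_cf_expansion: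
  "stake n (cf_expansion x) = map (\<lambda>i. \<lfloor>complete_quotient x i\<rfloor>) [0..<n]"
  by (simp add: cf_expansion_def complete_quotient_def cf_step_def[abs_def])

lemma inverse_irrational:
  fixes x :: real
  assumes "x \<notin> \<rat>" shows "1 / x \<notin> \<rat>"
proof
  assume "1 / x \<in> \<rat>"
  hence "1 / (1 / x) \<in> \<rat>" by (rule Rats_divide[OF Rats_1])
  moreover have "1 / (1 / x) = x" by simp
  ultimately show False using assms by metis
qed

lemma frac_pos_of_irrational: "x \<notin> \<rat> \<Longrightarrow> frac x > 0"
  by (metis Ints_subset_Rats frac_gt_0_iff subsetD)

lemma cf_step_irrational:
  assumes "x \<notin> \<rat>"
  shows "cf_step x \<notin> \<rat>" and "cf_step x > 1" and "x = \<lfloor>x\<rfloor> + 1 / cf_step x"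
proof -
  have pos: "frac x > 0" and lt: "frac x < 1"
    using frac_pos_of_irrational[OF assms] by (auto simp: frac_lt_1)
  have x: "x = \<lfloor>x\<rfloor> + frac x" by (simp add: frac_def)
  show "cf_step x > 1" using pos lt by (simp add: cf_step_def)
  show "x = \<lfloor>x\<rfloor> + 1 / cf_step x" using x by (simp add: cf_step_def)
  show "cf_step x \<notin> \<rat>"
  proof
    assume "cf_step x \<in> \<rat>"
    hence "1 / cf_step x \<in> \<rat>" by simp
    hence "frac x \<in> \<rat>" by (simp add: cf_step_def)
    hence "\<lfloor>x\<rfloor> + frac x \<in> \<rat>" by simp
    with x assms show False by simp
  qed
qed

lemma complete_quotient_irrational: "x \<notin> \<rat> \<Longrightarrow> complete_quotient x n \<notin> \<rat>"
  by (induction n) (auto simp: complete_quotient_Suc cf_step_irrational(1))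

lemma complete_quotient_gt_1: "x \<notin> \<rat> \<Longrightarrow> n > 0 \<Longrightarrow> complete_quotient x n > 1"
  by (cases n) (auto simp: complete_quotient_Suc cf_step_irrational(2) complete_quotient_irrational)

lemma complete_quotient_decomp:
  "x \<notin> \<rat> \<Longrightarrow>
    complete_quotient x n = \<lfloor>complete_quotient x n\<rfloor> + 1 / complete_quotient x (Suc n)"
  unfolding complete_quotient_Suc
  by (rule cf_step_irrational(3)) (rule complete_quotient_irrational)

text \<open>This recognises one step of the algorithm in the backward direction, from the quotient to the
number. It is how the steps of numbers given only through conjugates are computed.\<close>

lemma cf_step_eqI:
  assumes "x = of_int k + 1 / y" and "y > 1"
  shows "\<lfloor>x\<rfloor> = k" and "cf_step x = y"
proof -
  show f: "\<lfloor>x\<rfloor> = k" using assms by (intro floor_unique) auto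
  show "cf_step x = y" using assms f by (simp add: cf_step_def frac_def)
qed

text \<open>Coinduction on the rotations of \<open>bs\<close>: if \<open>s\<close> repeats \<open>bs\<close>, then the tail of \<open>s\<close> repeats
the list \<open>bs\<close> rotated by one.\<close>

lemma eq_cycleI: "s = bs @- s \<Longrightarrow> bs \<noteq> [] \<Longrightarrow> s = cycle bs"
proof (coinduction arbitrary: s bs)
  case (Eq_stream s bs)
  obtain b bs' where bs: "bs = b # bs'" using Eq_stream(2) by (cases bs) auto
  have s: "s = b ## (bs' @- s)" using Eq_stream(1) bs by simp
  have hd: "shd s = b" and tl: "stl s = bs' @- s"
    by (subst s, simp)+
  have "(bs' @ [b]) @- (bs' @- s) = bs' @- (b ## (bs' @- s))" by simp
  also have "\<dots> = bs' @- s" by (simp only: s[symmetric])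
  finally have "stl s = (bs' @ [b]) @- stl s" unfolding tl by simp
  with hd bs show ?case
    by (intro conjI exI[of _ "stl s"] exI[of _ "bs' @ [b]"]) simp_all
qed

lemma cf_expansion_eq_cycleI:
  assumes "complete_quotient x k = x" and "k > 0"
  shows "cf_expansion x = cycle (map (\<lambda>i. \<lfloor>complete_quotient x i\<rfloor>) [0..<k])"
proof (rule eq_cycleI)
  show "cf_expansion x = map (\<lambda>i. \<lfloor>complete_quotient x i\<rfloor>) [0..<k] @- cf_expansion x"
    using stake_sdrop[of k "cf_expansion x"] assms
    by (simp add: stake_cf_expansion sdrop_cf_expansion)
qed (use assms in simp)

text \<open>One step of the algorithm multiplies a difference by \<open>x1 * y1\<close>, which may be arbitrarily close
to \<open>1\<close>. Over two steps the factor \<open>(x1 * x2) * (y1 * y2)\<close> is at least \<open>4\<close>, because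
\<open>x1 * x2 = b * x2 + 1 > 2\<close>.\<close>

lemma two_steps_contract:
  fixes a b x y x1 y1 x2 y2 :: real
  assumes "x = a + 1 / x1" "y = a + 1 / y1" "x1 = b + 1 / x2" "y1 = b + 1 / y2"
    and "x1 > 1" "y1 > 1" "x2 > 1" "y2 > 1" "b \<ge> 1"
  shows "4 * \<bar>x - y\<bar> \<le> \<bar>x2 - y2\<bar>"
proof -
  have "x1 * x2 = b * x2 + 1" "y1 * y2 = b * y2 + 1"
    using assms by (simp_all add: field_simps)
  moreover have "b * x2 \<ge> 1" "b * y2 \<ge> 1"
    using mult_mono[of 1 b 1 x2] mult_mono[of 1 b 1 y2] assms by auto
  ultimately have "(x1 * x2) * (y1 * y2) \<ge> 2 * 2"
    by (intro mult_mono) auto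
  moreover have "x2 - y2 = (x - y) * ((x1 * x2) * (y1 * y2))"
  proof -
    have "x - y = 1 / x1 - 1 / y1" "y1 - x1 = 1 / y2 - 1 / x2"
      using assms(1-4) by linarith+
    moreover have "1 / x1 - 1 / y1 = (y1 - x1) / (x1 * y1)"
        "1 / y2 - 1 / x2 = (x2 - y2) / (x2 * y2)"
      using assms(5-8) by (simp_all add: field_simps)
    ultimately have d1: "x - y = (y1 - x1) / (x1 * y1)" and d2: "y1 - x1 = (x2 - y2) / (x2 * y2)"
      by simp_all
    show ?thesis unfolding d1 d2 using assms by simp
  qed
  ultimately obtain P where P: "x2 - y2 = (x - y) * P" "P \<ge> 4" by auto
  thus ?thesis using mult_left_mono[of 4 P "\<bar>x - y\<bar>"] by (simp add: abs_mult)
qed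

text \<open>All pairs of complete quotients lie at distance less than \<open>1\<close>, since their floors agree; on the
other hand a nonzero distance would grow by a factor of at least \<open>4\<close> every two steps.\<close>

lemma eq_if_cf_expansion_eq:
  assumes "x \<notin> \<rat>" "y \<notin> \<rat>" "cf_expansion x = cf_expansion y"
  shows "x = y"
proof -
  have fl: "\<lfloor>complete_quotient x n\<rfloor> = \<lfloor>complete_quotient y n\<rfloor>" for n
    using assms(3) by (metis cf_expansion_snth)
  let ?d = "\<lambda>n. \<bar>complete_quotient x n - complete_quotient y n\<bar>"
  have bound: "?d n < 1" for n
    using fl[of n] by linarith
  have contr: "4 * ?d n \<le> ?d (Suc (Suc n))" for n
  proof (rule two_steps_contract)
    show "complete_quotient x n = \<lfloor>complete_quotient x n\<rfloor> + 1 / complete_quotient x (Suc n)"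
      by (rule complete_quotient_decomp[OF assms(1)])
    show "complete_quotient y n = \<lfloor>complete_quotient x n\<rfloor> + 1 / complete_quotient y (Suc n)"
      unfolding fl by (rule complete_quotient_decomp[OF assms(2)])
    show "complete_quotient x (Suc n)
        = \<lfloor>complete_quotient x (Suc n)\<rfloor> + 1 / complete_quotient x (Suc (Suc n))"
      by (rule complete_quotient_decomp[OF assms(1)])
    show "complete_quotient y (Suc n)
        = \<lfloor>complete_quotient x (Suc n)\<rfloor> + 1 / complete_quotient y (Suc (Suc n))"
      unfolding fl by (rule complete_quotient_decomp[OF assms(2)])
    show "1 \<le> real_of_int \<lfloor>complete_quotient x (Suc n)\<rfloor>"
      using complete_quotient_gt_1[OF assms(1), of "Suc n"] by simp
  qed (use assms complete_quotient_gt_1 in auto)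
  have "4 ^ k * ?d 0 \<le> ?d (2 * k)" for k
  proof (induction k)
    case (Suc k)
    then show ?case using contr[of "2 * k"] by simp
  qed simp
  hence small: "4 ^ k * \<bar>x - y\<bar> < 1" for k
    using bound le_less_trans by (metis complete_quotient_0)
  show ?thesis
  proof (rule ccontr)
    assume "x \<noteq> y"
    then obtain k where "1 / \<bar>x - y\<bar> < 4 ^ k"
      using real_arch_pow[of 4 "1 / \<bar>x - y\<bar>"] by auto
    with small[of k] \<open>x \<noteq> y\<close> show False by (simp add: field_simps)
  qed
qed

section \<open>Unimodular equivalence\<close>

definition moebius_equiv :: "real \<Rightarrow> real \<Rightarrow> bool" where
  "moebius_equiv x y \<longleftrightarrow>
    (\<exists>(a::int) (b::int) (c::int) (d::int). \<bar>a * d - b * c\<bar> = 1 \<and>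
      of_int c * y + of_int d \<noteq> 0 \<and>
      x = (of_int a * y + of_int b) / (of_int c * y + of_int d))"

lemma moebius_equiv_sym:
  assumes "moebius_equiv x y" shows "moebius_equiv y x"
proof -
  obtain a b c d :: int where det: "\<bar>a * d - b * c\<bar> = 1" and nz: "c * y + d \<noteq> 0"
    and x: "x = (a * y + b) / (c * y + d)"
    using assms unfolding moebius_equiv_def by blast
  have detr: "real_of_int a * d - real_of_int b * c \<noteq> 0"
    using det by (metis abs_zero of_int_0_eq_iff of_int_diff of_int_mult zero_neq_one)
  have x': "x * (c * y + d) = a * y + b" using x nz by simp
  have e: "(a - c * x) * (c * y + d) = real_of_int a * d - real_of_int b * c"
    using x' by algebra
  hence nz': "a - c * x \<noteq> 0" using detr by auto
  have "y * (a - c * x) = d * x - b" using x' by algebra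
  hence "y = (d * x + (-b)) / ((-c) * x + a)"
    using nz' by (simp add: field_simps)
  thus ?thesis unfolding moebius_equiv_def
    using det nz' by (intro exI[of _ d] exI[of _ "-b"] exI[of _ "-c"] exI[of _ a])
      (auto simp: algebra_simps)
qed

lemma moebius_equiv_trans [trans]:
  assumes "moebius_equiv x y" "moebius_equiv y z" shows "moebius_equiv x z"
proof -
  obtain a b c d :: int where det: "\<bar>a * d - b * c\<bar> = 1" and nz: "c * y + d \<noteq> 0"
    and x: "x = (a * y + b) / (c * y + d)"
    using assms(1) unfolding moebius_equiv_def by blast
  obtain a' b' c' d' :: int where det': "\<bar>a' * d' - b' * c'\<bar> = 1" and nz': "c' * z + d' \<noteq> 0"
    and y: "y = (a' * z + b') / (c' * z + d')"
    using assms(2) unfolding moebius_equiv_def by blast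
  define w where "w = c' * z + d'"
  have yw: "y * w = a' * z + b'" using y nz' w_def by simp
  have n: "(a * y + b) * w = (a * a' + b * c') * z + (a * b' + b * d')"
    using yw w_def unfolding of_int_add of_int_mult by algebra
  have dn: "(c * y + d) * w = (c * a' + d * c') * z + (c * b' + d * d')"
    using yw w_def unfolding of_int_add of_int_mult by algebra
  have w0: "w \<noteq> 0" using nz' w_def by simp
  have "x = ((a * y + b) * w) / ((c * y + d) * w)" using x w0 by simp
  moreover have "(c * y + d) * w \<noteq> 0" using nz w0 by simp
  moreover have "(a * a' + b * c') * (c * b' + d * d') - (a * b' + b * d') * (c * a' + d * c')
      = (a * d - b * c) * (a' * d' - b' * c')" by algebra
  ultimately show ?thesis unfolding moebius_equiv_def n dn
    using det det' by (intro exI[of _ "a * a' + b * c'"] exI[of _ "a * b' + b * d'"]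
      exI[of _ "c * a' + d * c'"] exI[of _ "c * b' + d * d'"]) (simp add: abs_mult)
qed

lemma moebius_equiv_uminus_inverse: "z \<noteq> 0 \<Longrightarrow> moebius_equiv (-1 / z) z"
  unfolding moebius_equiv_def
  by (intro exI[of _ 0] exI[of _ "-1"] exI[of _ 1] exI[of _ 0]) auto

lemma moebius_equiv_complete_quotient:
  assumes "x \<notin> \<rat>" shows "moebius_equiv x (complete_quotient x n)"
proof (induction n)
  case 0
  show ?case unfolding moebius_equiv_def
    by (intro exI[of _ 1] exI[of _ 0] exI[of _ 0] exI[of _ 1]) auto
next
  case (Suc n)
  let ?y = "complete_quotient x n" and ?z = "complete_quotient x (Suc n)"
  have z: "?z > 1" by (rule complete_quotient_gt_1) (use assms in auto)
  have "?y = (\<lfloor>?y\<rfloor> * ?z + 1) / (1 * ?z + 0)"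
    using complete_quotient_decomp[OF assms, of n] z by (simp add: field_simps)
  hence "moebius_equiv ?y ?z" unfolding moebius_equiv_def using z
    by (intro exI[of _ "\<lfloor>?y\<rfloor>"] exI[of _ 1] exI[of _ 1] exI[of _ 0]) auto
  with Suc show ?case by (rule moebius_equiv_trans)
qed

definition tail_equiv :: "real \<Rightarrow> real \<Rightarrow> bool" where
  "tail_equiv x y \<longleftrightarrow> (\<exists>i j. complete_quotient x i = complete_quotient y j)"

lemma tail_equiv_sym: "tail_equiv x y \<Longrightarrow> tail_equiv y x"
  unfolding tail_equiv_def by metis

lemma tail_equiv_trans [trans]:
  assumes "tail_equiv x y" "tail_equiv y z" shows "tail_equiv x z"
proof -
  obtain i j k l where 1: "complete_quotient x i = complete_quotient y j"
    and 2: "complete_quotient y k = complete_quotient z l"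
    using assms unfolding tail_equiv_def by blast
  have "complete_quotient x (i + k) = complete_quotient z (l + j)"
    using 1 2 by (metis complete_quotient_add add.commute)
  thus ?thesis unfolding tail_equiv_def by blast
qed

lemma tail_equivI1: "cf_step x = y \<Longrightarrow> tail_equiv x y"
  unfolding tail_equiv_def
  by (intro exI[of _ "Suc 0"] exI[of _ 0]) (simp add: complete_quotient_Suc)

lemma tail_equiv_add_int: "tail_equiv (x + of_int k) x"
  unfolding tail_equiv_def
  by (intro exI[of _ "Suc 0"]) (simp add: complete_quotient_Suc cf_step_def frac_def)

lemma tail_equiv_inverse_pos:
  assumes "x \<notin> \<rat>" "x > 0" shows "tail_equiv (1 / x) x"
proof -
  have lt: "tail_equiv y (1 / y)" if "0 < y" "y < 1" for y
    using that by (intro tail_equivI1) (simp add: cf_step_def frac_eq)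
  have "x \<noteq> 1" using assms by auto
  then consider "x < 1" | "x > 1" by linarith
  thus ?thesis
  proof cases
    case 1
    thus ?thesis using lt[of x] assms tail_equiv_sym by blast
  next
    case 2
    thus ?thesis using lt[of "1 / x"] by simp
  qed
qed

text \<open>Modulo integers, \<open>-x\<close> is \<open>1 - t\<close> with \<open>t = frac x\<close>. Translations and inversions of positive
numbers lead from there to \<open>t\<close> along
\<open>1 - t, 1/(1 - t), t/(1 - t), (1 - t)/t, 1/t, t\<close>.\<close>

lemma tail_equiv_uminus:
  assumes "x \<notin> \<rat>" shows "tail_equiv (- x) x"
proof -
  define t where "t = frac x"
  have t: "0 < t" "t < 1" using frac_pos_of_irrational[OF assms] frac_lt_1 t_def by auto
  have x: "x = t + of_int \<lfloor>x\<rfloor>" by (simp add: t_def frac_def)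
  have tirr: "t \<notin> \<rat>" using assms x by (metis Rats_add Rats_of_int)
  have irr: "1 - t \<notin> \<rat>" using tirr by (metis Rats_1 Rats_diff diff_diff_eq2 add_diff_cancel_left')
  have irr2: "t / (1 - t) \<notin> \<rat>"
  proof
    assume "t / (1 - t) \<in> \<rat>"
    hence "1 / (t / (1 - t) + 1) \<in> \<rat>" by simp
    moreover have "1 / (t / (1 - t) + 1) = 1 - t" using t by (simp add: field_simps)
    ultimately show False using irr by simp
  qed
  have "- x = (1 - t) + of_int (- \<lfloor>x\<rfloor> - 1)" using x by simp
  hence "tail_equiv (- x) (1 - t)" using tail_equiv_add_int by metis
  also have "tail_equiv (1 - t) (1 / (1 - t))"
    using tail_equiv_inverse_pos[OF irr] t tail_equiv_sym by simp
  also have "1 / (1 - t) = t / (1 - t) + of_int 1" using t by (simp add: field_simps)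
  also have "tail_equiv (t / (1 - t) + of_int 1) (t / (1 - t))" by (rule tail_equiv_add_int)
  also have "tail_equiv (t / (1 - t)) (1 / (t / (1 - t)))"
    using tail_equiv_inverse_pos[OF irr2] t tail_equiv_sym by simp
  also have "1 / (t / (1 - t)) = 1 / t + of_int (-1)" using t by (simp add: field_simps)
  also have "tail_equiv (1 / t + of_int (-1)) (1 / t)" by (rule tail_equiv_add_int)
  also have "tail_equiv (1 / t) t" using tail_equiv_inverse_pos[OF tirr] t by simp
  also have "tail_equiv t x" using tail_equiv_add_int[of t "\<lfloor>x\<rfloor>"] x tail_equiv_sym by simp
  finally show ?thesis .
qed

lemma tail_equiv_inverse:
  assumes "x \<notin> \<rat>" shows "tail_equiv (1 / x) x"
proof (cases "x > 0")
  case False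
  have irr: "- x \<notin> \<rat>" using assms by simp
  have "x \<noteq> 0" using assms by auto
  hence pos: "- x > 0" using False by simp
  have "1 / - x \<notin> \<rat>" using inverse_irrational[OF irr] .
  hence "tail_equiv (- (1 / - x)) (1 / - x)" by (rule tail_equiv_uminus)
  also have "- (1 / - x) = 1 / x" by simp
  also have "tail_equiv (1 / - x) (- x)" using tail_equiv_inverse_pos irr pos by blast
  also have "tail_equiv (- x) x" using tail_equiv_uminus assms by blast
  finally show ?thesis by simp
qed (use tail_equiv_inverse_pos assms in blast)

lemma moebius_irrational:
  fixes a b c d :: int and y :: real
  assumes "y \<notin> \<rat>" "\<bar>a * d - b * c\<bar> = 1"
  shows "(a * y + b) / (c * y + d) \<notin> \<rat>"
proof
  assume R: "(a * y + b) / (c * y + d) \<in> \<rat>"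
  define x where "x = (a * y + b) / (c * y + d)"
  have "c * y + d \<noteq> 0"
  proof
    assume 0: "c * y + d = 0"
    have "c = 0"
    proof (rule ccontr)
      assume "c \<noteq> 0"
      hence "y = - d / c" using 0 by (simp add: field_simps)
      thus False using assms(1) by simp
    qed
    with 0 assms(2) show False by simp
  qed
  hence "moebius_equiv x y"
    unfolding moebius_equiv_def x_def using assms(2) by blast
  hence "moebius_equiv y x" by (rule moebius_equiv_sym)
  then obtain a b c d :: int where "y = (a * x + b) / (c * x + d)"
    unfolding moebius_equiv_def by blast
  hence "y \<in> \<rat>" using R unfolding x_def[symmetric] by simp
  thus False using assms(1) by simp
qed

text \<open>The hard direction of Serret's theorem. Translations, inversion and negation generate all
integral Moebius transformations of determinant \<open>1\<close> or \<open>-1\<close>, and each of them preserves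
tails. The Euclidean algorithm on the first column of the matrix carries out the reduction:
subtracting \<open>a div c\<close> and inverting replaces the lower left entry \<open>c\<close> by \<open>a mod c\<close>.\<close>

lemma tail_equiv_moebius:
  fixes a b c d :: int and y :: real
  assumes "y \<notin> \<rat>" "\<bar>a * d - b * c\<bar> = 1"
  shows "tail_equiv ((a * y + b) / (c * y + d)) y"
  using assms(2)
proof (induction "nat \<bar>c\<bar>" arbitrary: a b c d rule: less_induct)
  case less
  show ?case
  proof (cases "c = 0")
    case True
    hence "\<bar>a\<bar> * \<bar>d\<bar> = 1" using less.prems by (simp add: abs_mult)
    hence ad: "\<bar>a\<bar> = 1" "\<bar>d\<bar> = 1" using zmult_eq_1_iff by fastforce+
    define u where "u = (if a = d then y else - y)"
    have "(a * y + b) / (c * y + d) = u + of_int (b * d)"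
      using ad True by (auto simp: u_def abs_if split: if_splits)
    moreover have "tail_equiv u y"
      using tail_equiv_uminus[OF assms(1)] tail_equiv_add_int[of y 0] by (simp add: u_def)
    ultimately show ?thesis using tail_equiv_add_int tail_equiv_trans by metis
  next
    case False
    define k where "k = a div c"
    define a' where "a' = a - k * c"
    define b' where "b' = b - k * d"
    have a': "a' = a mod c" unfolding a'_def k_def by (simp add: minus_div_mult_eq_mod)
    have "nat \<bar>a'\<bar> < nat \<bar>c\<bar>" unfolding a' using False abs_mod_less[of c a] by simp
    moreover have det: "\<bar>c * b' - d * a'\<bar> = 1"
    proof -
      have "c * b' - d * a' = - (a * d - b * c)" unfolding a'_def b'_def by algebra
      thus ?thesis using less.prems by simp
    qed
    ultimately have IH: "tail_equiv ((c * y + d) / (a' * y + b')) y" by (rule less.hyps)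
    have irr: "(c * y + d) / (a' * y + b') \<notin> \<rat>" by (rule moebius_irrational[OF assms(1) det])
    have nz: "c * y + d \<noteq> 0" using irr by auto
    have "(a * y + b) / (c * y + d) = 1 / ((c * y + d) / (a' * y + b')) + of_int k"
      using nz by (simp add: a'_def b'_def field_simps)
    hence "tail_equiv ((a * y + b) / (c * y + d)) (1 / ((c * y + d) / (a' * y + b')))"
      using tail_equiv_add_int by metis
    also have "tail_equiv \<dots> ((c * y + d) / (a' * y + b'))" by (rule tail_equiv_inverse[OF irr])
    also note IH
    finally show ?thesis .
  qed
qed

lemma tail_equiv_if_moebius_equiv:
  "moebius_equiv x y \<Longrightarrow> y \<notin> \<rat> \<Longrightarrow> tail_equiv x y"
  unfolding moebius_equiv_def using tail_equiv_moebius by blast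

section \<open>Conjugation in a real quadratic field\<close>

text \<open>The irrational \<open>s\<close> plays the part of a square root of a rational number. Conjugation is the
automorphism that fixes the rationals and maps \<open>s\<close> to \<open>-s\<close>.\<close>

locale real_quadratic_field =
  fixes s :: real
  assumes s_irrational: "s \<notin> \<rat>" and s_squared: "s\<^sup>2 \<in> \<rat>"
begin

definition K :: "real set" where
  "K = {a + b * s | a b. a \<in> \<rat> \<and> b \<in> \<rat>}"

definition conjugate :: "real \<Rightarrow> real" where
  "conjugate x = (THE y. \<exists>a\<in>\<rat>. \<exists>b\<in>\<rat>. x = a + b * s \<and> y = a - b * s)"

lemma K_I [intro]: "a \<in> \<rat> \<Longrightarrow> b \<in> \<rat> \<Longrightarrow> a + b * s \<in> K"
  by (auto simp: K_def)

lemma K_E: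
  assumes "x \<in> K" obtains a b where "a \<in> \<rat>" "b \<in> \<rat>" "x = a + b * s"
  using assms by (auto simp: K_def)

lemma coords_unique:
  assumes "a \<in> \<rat>" "b \<in> \<rat>" "a' \<in> \<rat>" "b' \<in> \<rat>" "a + b * s = a' + b' * s"
  shows "a = a'" and "b = b'"
proof -
  show "b = b'"
  proof (rule ccontr)
    assume "b \<noteq> b'"
    hence "s = (a' - a) / (b - b')" using assms(5) by (simp add: field_simps)
    thus False using assms(1-4) s_irrational by simp
  qed
  thus "a = a'" using assms(5) by simp
qed

lemma conjugate_eq:
  assumes "a \<in> \<rat>" "b \<in> \<rat>" shows "conjugate (a + b * s) = a - b * s"
  unfolding conjugate_def
proof (rule the_equality)
  show "\<exists>a'\<in>\<rat>. \<exists>b'\<in>\<rat>. a + b * s = a' + b' * s \<and> a - b * s = a' - b' * s"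
    using assms by blast
next
  fix y assume "\<exists>a'\<in>\<rat>. \<exists>b'\<in>\<rat>. a + b * s = a' + b' * s \<and> y = a' - b' * s"
  then obtain a' b' where 1: "a' \<in> \<rat>" "b' \<in> \<rat>" "a + b * s = a' + b' * s" "y = a' - b' * s"
    by blast
  show "y = a - b * s" using coords_unique[OF assms 1(1,2,3)] 1(4) by simp
qed

lemma Rats_in_K: "a \<in> \<rat> \<Longrightarrow> a \<in> K"
  using K_I[of a 0] by simp

lemma conjugate_Rats: "a \<in> \<rat> \<Longrightarrow> conjugate a = a"
  using conjugate_eq[of a 0] by simp

lemma
  assumes "x \<in> K" "y \<in> K"
  shows K_add: "x + y \<in> K" and conjugate_add: "conjugate (x + y) = conjugate x + conjugate y"
proof -
  obtain a b where x: "a \<in> \<rat>" "b \<in> \<rat>" "x = a + b * s" using assms(1) by (rule K_E)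
  obtain c d where y: "c \<in> \<rat>" "d \<in> \<rat>" "y = c + d * s" using assms(2) by (rule K_E)
  have xy: "x + y = (a + c) + (b + d) * s" using x y by (simp add: algebra_simps)
  show "x + y \<in> K" unfolding xy using x y by (intro K_I) auto
  show "conjugate (x + y) = conjugate x + conjugate y"
    unfolding xy using x y by (simp add: conjugate_eq) (simp add: algebra_simps)
qed

lemma
  assumes "x \<in> K" "y \<in> K"
  shows K_mult: "x * y \<in> K" and conjugate_mult: "conjugate (x * y) = conjugate x * conjugate y"
proof -
  obtain a b where x: "a \<in> \<rat>" "b \<in> \<rat>" "x = a + b * s" using assms(1) by (rule K_E)
  obtain c d where y: "c \<in> \<rat>" "d \<in> \<rat>" "y = c + d * s" using assms(2) by (rule K_E)
  have xy: "x * y = (a * c + b * d * s\<^sup>2) + (a * d + b * c) * s"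
    using x y by (simp add: algebra_simps power2_eq_square)
  show "x * y \<in> K" unfolding xy using x y s_squared by (intro K_I Rats_add Rats_mult)
  have "conjugate (x * y) = (a * c + b * d * s\<^sup>2) - (a * d + b * c) * s"
    unfolding xy using x y s_squared by (intro conjugate_eq Rats_add Rats_mult)
  also have "\<dots> = (a - b * s) * (c - d * s)" by (simp add: algebra_simps power2_eq_square)
  also have "\<dots> = conjugate x * conjugate y" using x y by (simp add: conjugate_eq)
  finally show "conjugate (x * y) = conjugate x * conjugate y" .
qed

lemma conjugate_eq_0_iff:
  assumes "x \<in> K" shows "conjugate x = 0 \<longleftrightarrow> x = 0"
proof -
  obtain a b where x: "a \<in> \<rat>" "b \<in> \<rat>" "x = a + b * s" using assms by (rule K_E)
  have "a = 0 \<and> b = 0" if "a - b * s = 0"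
    using coords_unique[of a "-b" 0 0] that x by simp
  moreover have "a = 0 \<and> b = 0" if "a + b * s = 0"
    using coords_unique[of a b 0 0] that x by simp
  moreover have "conjugate x = a - b * s" using x by (simp add: conjugate_eq)
  ultimately show ?thesis using x by auto
qed

lemma
  assumes "x \<in> K"
  shows K_inverse: "1 / x \<in> K" and conjugate_inverse: "conjugate (1 / x) = 1 / conjugate x"
proof -
  show K: "1 / x \<in> K"
  proof (cases "x = 0")
    case False
    obtain a b where x: "a \<in> \<rat>" "b \<in> \<rat>" "x = a + b * s" using assms by (rule K_E)
    define n where "n = a\<^sup>2 - b\<^sup>2 * s\<^sup>2"
    have n: "n \<in> \<rat>" unfolding n_def using x s_squared by simp
    have "conjugate x \<noteq> 0" using conjugate_eq_0_iff[OF assms] False by simp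
    hence nz: "a - b * s \<noteq> 0" using x by (simp add: conjugate_eq)
    have nx: "n = x * (a - b * s)" unfolding n_def x(3)
      by (simp add: algebra_simps power2_eq_square)
    have "1 / x = (a - b * s) / n" using nx nz by simp
    also have "\<dots> = a / n + (- b / n) * s" by (simp add: diff_divide_distrib)
    also have "\<dots> \<in> K" using x n by (intro K_I) auto
    finally show ?thesis .
  qed (simp add: Rats_in_K)
  show "conjugate (1 / x) = 1 / conjugate x"
  proof (cases "x = 0")
    case False
    have "conjugate (1 / x) * conjugate x = conjugate (1 / x * x)"
      using conjugate_mult[OF K assms] by simp
    also have "\<dots> = 1" using False by (simp add: conjugate_Rats)
    finally show ?thesis using conjugate_eq_0_iff[OF assms] False by (simp add: field_simps)
  qed (simp add: conjugate_Rats)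
qed

lemma conjugate_irrational:
  assumes "x \<in> K" "x \<notin> \<rat>"
  shows "conjugate x \<notin> \<rat>" and "conjugate x \<noteq> x"
proof -
  obtain a b where x: "a \<in> \<rat>" "b \<in> \<rat>" "x = a + b * s" using assms(1) by (rule K_E)
  have b: "b \<noteq> 0" using x assms(2) by auto
  have c: "conjugate x = a - b * s" using x by (simp add: conjugate_eq)
  show "conjugate x \<noteq> x" using c x b s_irrational by auto
  show "conjugate x \<notin> \<rat>"
  proof
    assume "conjugate x \<in> \<rat>"
    hence "(a - conjugate x) / b \<in> \<rat>" using x by simp
    moreover have "(a - conjugate x) / b = s" using b c by simp
    ultimately show False using s_irrational by simp
  qed
qed

lemma conjugate_affine:
  assumes "x \<in> K" "a \<in> \<rat>" "b \<in> \<rat>"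
  shows "a * x + b \<in> K" and "conjugate (a * x + b) = a * conjugate x + b"
  using assms by (simp_all add: K_add K_mult Rats_in_K conjugate_add conjugate_mult conjugate_Rats)

lemma moebius_equiv_conjugate:
  assumes "moebius_equiv x y" "y \<in> K"
  shows "moebius_equiv (conjugate x) (conjugate y)"
proof -
  obtain a b c d :: int where det: "\<bar>a * d - b * c\<bar> = 1" and nz: "c * y + d \<noteq> 0"
    and x: "x = (a * y + b) / (c * y + d)"
    using assms(1) unfolding moebius_equiv_def by blast
  have n: "a * y + b \<in> K" "conjugate (a * y + b) = a * conjugate y + b"
    and dn: "c * y + d \<in> K" "conjugate (c * y + d) = c * conjugate y + d"
    using conjugate_affine[OF assms(2)] by auto
  have "x = (a * y + b) * (1 / (c * y + d))" using x by simp
  hence "conjugate x = (a * conjugate y + b) * (1 / (c * conjugate y + d))"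
    using n dn by (simp only: conjugate_mult K_inverse conjugate_inverse)
  moreover have "c * conjugate y + d \<noteq> 0"
    using nz conjugate_eq_0_iff[OF dn(1)] dn(2) by simp
  ultimately show ?thesis unfolding moebius_equiv_def using det by auto
qed

section \<open>Reduced complete quotients\<close>

lemma
  assumes "x \<in> K"
  shows cf_step_K: "cf_step x \<in> K"
    and conjugate_cf_step: "conjugate (cf_step x) = 1 / (conjugate x - \<lfloor>x\<rfloor>)"
proof -
  have "cf_step x = 1 / (1 * x + (- \<lfloor>x\<rfloor>))" by (simp add: cf_step_def frac_def)
  thus "cf_step x \<in> K" "conjugate (cf_step x) = 1 / (conjugate x - \<lfloor>x\<rfloor>)"
    using conjugate_affine[OF assms, of 1 "- \<lfloor>x\<rfloor>"]
    by (simp_all add: K_inverse conjugate_inverse)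
qed

lemma complete_quotient_K: "x \<in> K \<Longrightarrow> complete_quotient x n \<in> K"
  by (induction n) (auto simp: complete_quotient_Suc cf_step_K)

lemma conjugate_complete_quotient_decomp:
  assumes "x \<in> K" "x \<notin> \<rat>"
  shows "conjugate (complete_quotient x n)
    = \<lfloor>complete_quotient x n\<rfloor> + 1 / conjugate (complete_quotient x (Suc n))"
  unfolding complete_quotient_Suc using conjugate_cf_step[OF complete_quotient_K[OF assms(1)]]
  by simp

definition reduced :: "real \<Rightarrow> bool" where
  "reduced y \<longleftrightarrow> y > 1 \<and> -1 < conjugate y \<and> conjugate y < 0"

lemma reduced_cf_step:
  assumes "y \<in> K" "y \<notin> \<rat>" "y > 1" "conjugate y < 0"
  shows "reduced (cf_step y)"
proof -
  have "real_of_int \<lfloor>y\<rfloor> \<ge> 1" using assms(3) by simp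
  hence "conjugate y - \<lfloor>y\<rfloor> < -1" using assms(4) by linarith
  hence "-1 < 1 / (conjugate y - \<lfloor>y\<rfloor>)" "1 / (conjugate y - \<lfloor>y\<rfloor>) < 0"
    by (simp_all add: field_simps)
  thus ?thesis
    unfolding reduced_def conjugate_cf_step[OF assms(1)] using cf_step_irrational(2)[OF assms(2)]
    by blast
qed

text \<open>If all conjugates stayed positive, the relation between the conjugates of consecutive complete
quotients would make each of them after the initial one larger than \<open>1\<close>. The conjugates would then be the complete
quotients of \<open>conjugate x\<close>, with the same floors as those of \<open>x\<close>, so that \<open>x\<close> and
\<open>conjugate x\<close> would have the same expansion and be equal.\<close>

lemma exists_negative_conjugate:
  assumes "x \<in> K" "x \<notin> \<rat>"
  shows "\<exists>n>0. conjugate (complete_quotient x n) < 0"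
proof (rule ccontr)
  assume "\<not> (\<exists>n>0. conjugate (complete_quotient x n) < 0)"
  moreover have "conjugate (complete_quotient x n) \<noteq> 0" for n
    using conjugate_irrational(1)[OF complete_quotient_K complete_quotient_irrational] assms
    by (metis Rats_0)
  ultimately have pos: "conjugate (complete_quotient x n) > 0" if "n > 0" for n
    using that by (metis linorder_neqE_linordered_idom)
  have gt1: "conjugate (complete_quotient x (Suc n)) > 1" for n
  proof -
    have "real_of_int \<lfloor>complete_quotient x (Suc n)\<rfloor> \<ge> 1"
      using complete_quotient_gt_1[OF assms(2), of "Suc n"] by simp
    moreover have "1 / conjugate (complete_quotient x (Suc (Suc n))) > 0" using pos by simp
    ultimately show ?thesis
      using conjugate_complete_quotient_decomp[OF assms, of "Suc n"] by linarith
  qed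
  have fl: "\<lfloor>conjugate (complete_quotient x n)\<rfloor> = \<lfloor>complete_quotient x n\<rfloor>"
    and st: "cf_step (conjugate (complete_quotient x n)) = conjugate (complete_quotient x (Suc n))"
    for n
    using cf_step_eqI[OF conjugate_complete_quotient_decomp[OF assms] gt1] by blast+
  have cq: "complete_quotient (conjugate x) n = conjugate (complete_quotient x n)" for n
    by (induction n) (simp_all add: complete_quotient_Suc, metis complete_quotient_Suc st)
  have "cf_expansion (conjugate x) !! n = cf_expansion x !! n" for n
    by (simp add: cf_expansion_snth cq fl)
  hence "cf_expansion (conjugate x) = cf_expansion x"
    using smap_alt[of id "cf_expansion (conjugate x)" "cf_expansion x"]
    by (simp add: stream.map_id)
  hence "conjugate x = x"
    using eq_if_cf_expansion_eq conjugate_irrational(1) assms by blast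
  thus False using conjugate_irrational(2) assms by blast
qed

lemma eventually_reduced:
  assumes "x \<in> K" "x \<notin> \<rat>"
  obtains N where "\<And>n. n \<ge> N \<Longrightarrow> reduced (complete_quotient x n)"
proof -
  obtain m where m: "m > 0" "conjugate (complete_quotient x m) < 0"
    using exists_negative_conjugate[OF assms] by blast
  have "reduced (complete_quotient x (Suc m + k))" for k
  proof (induction k)
    case 0
    show ?case
      using reduced_cf_step[OF complete_quotient_K complete_quotient_irrational] assms m
        complete_quotient_gt_1 by (simp add: complete_quotient_Suc)
  next
    case (Suc k)
    hence "reduced (cf_step (complete_quotient x (Suc m + k)))"
      using reduced_cf_step complete_quotient_K complete_quotient_irrational assms
      unfolding reduced_def by blast
    thus ?case by (simp only: complete_quotient_Suc add_Suc_right)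
  qed
  hence "reduced (complete_quotient x n)" if "n \<ge> Suc m" for n
    using that by (metis le_add_diff_inverse)
  thus ?thesis using that by blast
qed

end

section \<open>Periodicity\<close>

definition root_of_discriminant :: "int \<Rightarrow> real \<Rightarrow> int \<times> int \<times> int \<Rightarrow> bool" where
  "root_of_discriminant D x = (\<lambda>(a, b, c).
    a \<noteq> 0 \<and> of_int a * x\<^sup>2 + of_int b * x + of_int c = 0 \<and> b\<^sup>2 - 4 * a * c = D)"

text \<open>Substituting \<open>x = k + 1/y\<close> in a binary quadratic form is a unimodular change of variables, so
the discriminant of the equation does not change.\<close>

lemma root_of_discriminant_cf_step:
  assumes "root_of_discriminant D x t" "x \<notin> \<rat>"
  shows "\<exists>t'. root_of_discriminant D (cf_step x) t'"
proof -
  obtain a b c where t: "t = (a, b, c)" by (cases t)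
  have a0: "a \<noteq> 0" and root: "of_int a * x\<^sup>2 + of_int b * x + of_int c = 0"
    and disc: "b\<^sup>2 - 4 * a * c = D"
    using assms(1) by (auto simp: root_of_discriminant_def t)
  define y where "y = cf_step x"
  define k where "k = \<lfloor>x\<rfloor>"
  have y: "y \<notin> \<rat>" "y > 1" "x = k + 1 / y"
    using cf_step_irrational[OF assms(2)] by (auto simp: y_def k_def)
  define a' where "a' = a * k\<^sup>2 + b * k + c"
  define b' where "b' = 2 * a * k + b"
  have xy: "x * y = k * y + 1" using y by (simp add: field_simps)
  have "of_int a' * y\<^sup>2 + of_int b' * y + of_int a
      = (of_int a * x\<^sup>2 + of_int b * x + of_int c) * y\<^sup>2"
  proof -
    have "(of_int a * x\<^sup>2 + of_int b * x + of_int c) * y\<^sup>2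
        = of_int a * (x * y)\<^sup>2 + of_int b * (x * y) * y + of_int c * y\<^sup>2"
      by (simp add: algebra_simps power2_eq_square)
    also have "\<dots> = of_int a' * y\<^sup>2 + of_int b' * y + of_int a"
      unfolding xy a'_def b'_def by (simp add: algebra_simps power2_eq_square)
    finally show ?thesis by simp
  qed
  hence root': "of_int a' * y\<^sup>2 + of_int b' * y + of_int a = 0" using root by simp
  have "a' \<noteq> 0"
  proof
    assume "a' = 0"
    hence 1: "of_int b' * y + of_int a = 0" using root' by simp
    hence "b' \<noteq> 0" using a0 by auto
    hence "y = - of_int a / of_int b'" using 1 by (simp add: field_simps)
    thus False using y(1) by simp
  qed
  moreover have "b'\<^sup>2 - 4 * a' * a = D"
    unfolding a'_def b'_def disc[symmetric] by (simp add: algebra_simps power2_eq_square)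
  ultimately have "root_of_discriminant D y (a', b', a)"
    using root' by (simp add: root_of_discriminant_def)
  thus ?thesis unfolding y_def by blast
qed

lemma root_of_discriminant_complete_quotient:
  assumes "root_of_discriminant D x t" "x \<notin> \<rat>"
  shows "\<exists>t'. root_of_discriminant D (complete_quotient x n) t'"
proof (induction n)
  case (Suc n)
  thus ?case
    using root_of_discriminant_cf_step complete_quotient_irrational[OF assms(2)]
    by (metis complete_quotient_Suc)
next
  case 0
  show ?case using assms(1) unfolding complete_quotient_0 by blast
qed

context real_quadratic_field
begin

text \<open>The product \<open>c / a\<close> of the two roots \<open>y\<close> and \<open>conjugate y\<close> is negative.\<close>

lemma outer_coeffs_opposite_signs:
  assumes "y \<in> K" "y \<notin> \<rat>" "y > 0" "conjugate y < 0"
    and "root_of_discriminant D y (a, b, c)"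
  shows "a * c < 0"
proof -
  define w where "w = conjugate y"
  have root: "of_int a * y\<^sup>2 + of_int b * y + of_int c = 0" and a0: "a \<noteq> 0"
    using assms(5) by (auto simp: root_of_discriminant_def)
  have 1: "y * (of_int a * y + of_int b) + of_int c = 0"
    using root by (simp add: algebra_simps power2_eq_square)
  have "conjugate (y * (of_int a * y + of_int b) + of_int c)
      = w * (of_int a * w + of_int b) + of_int c"
    using assms(1) unfolding w_def
    by (simp add: conjugate_add conjugate_mult conjugate_Rats K_add K_mult Rats_in_K)
  hence 2: "w * (of_int a * w + of_int b) + of_int c = 0"
    unfolding 1 using conjugate_Rats[of 0] by simp
  have "(y - w) * (of_int a * (y + w) + of_int b) = 0" using 1 2 by algebra
  moreover have "y \<noteq> w" using assms(3,4) w_def by simp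
  ultimately have "of_int b = - of_int a * (y + w)" by simp
  hence "of_int c = of_int a * (y * w)" using 1 by algebra
  hence "real_of_int (a * c) = (of_int a)\<^sup>2 * (y * w)" by (simp add: power2_eq_square)
  also have "\<dots> < 0"
    using a0 assms(3,4) w_def by (simp add: mult_pos_neg)
  finally show ?thesis by (simp only: of_int_less_0_iff)
qed

end

lemma coeffs_bounded:
  fixes a b c D :: int
  assumes "a * c < 0" "b\<^sup>2 - 4 * a * c = D"
  shows "a \<in> {-D..D}" "b \<in> {-D..D}" "c \<in> {-D..D}"
proof -
  have nz: "a \<noteq> 0" "c \<noteq> 0" using assms(1) by auto
  have ac: "\<bar>a\<bar> * \<bar>c\<bar> = - (a * c)" using assms(1) by (simp add: abs_mult[symmetric])
  have "\<bar>a\<bar> * 1 \<le> \<bar>a\<bar> * \<bar>c\<bar>" "1 * \<bar>c\<bar> \<le> \<bar>a\<bar> * \<bar>c\<bar>"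
    using nz by (intro mult_mono; simp)+
  moreover have "\<bar>b\<bar> \<le> b\<^sup>2"
    using self_le_power[of "\<bar>b\<bar>" 2] by (cases "b = 0") auto
  moreover have "b\<^sup>2 \<ge> 0" by simp
  ultimately show "a \<in> {-D..D}" "b \<in> {-D..D}" "c \<in> {-D..D}"
    using assms ac unfolding atLeastAtMost_iff by linarith+
qed

lemma positive_root_unique:
  assumes "root_of_discriminant D y (a, b, c)" "root_of_discriminant D z (a, b, c)"
    and "a * c < 0" "y > 0" "z > 0"
  shows "y = z"
proof (rule ccontr)
  assume "y \<noteq> z"
  have 1: "of_int a * y\<^sup>2 + of_int b * y + of_int c = 0"
    and 2: "of_int a * z\<^sup>2 + of_int b * z + of_int c = 0"
    using assms(1,2) by (auto simp: root_of_discriminant_def)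
  have "(y - z) * (of_int a * (y + z) + of_int b) = 0" using 1 2 by algebra
  hence "of_int b = - of_int a * (y + z)" using \<open>y \<noteq> z\<close> by simp
  hence "of_int c = of_int a * (y * z)" using 1 by algebra
  hence "real_of_int (a * c) = (of_int a)\<^sup>2 * (y * z)" by (simp add: power2_eq_square)
  moreover have "(of_int a)\<^sup>2 * (y * z) \<ge> 0" using assms(4,5) by simp
  ultimately show False using assms(3) by (metis not_le of_int_less_0_iff)
qed

context real_quadratic_field
begin

text \<open>Lagrange's theorem. Eventually the complete quotients are reduced, hence positive with negative
conjugate. Their equations then have coefficients bounded in terms of the invariant
discriminant, so two of the complete quotients share an equation; its positive root is unique.\<close>

lemma complete_quotients_periodic:
  assumes "x \<in> K" "quadratic_irrational x"
  obtains n k where "k > 0" "complete_quotient (complete_quotient x n) k = complete_quotient x n"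
proof -
  have irr: "x \<notin> \<rat>" using assms(2) by (simp add: quadratic_irrational_def)
  obtain a b c :: int where "a \<noteq> 0" "of_int a * x\<^sup>2 + of_int b * x + of_int c = 0"
    using assms(2) by (auto simp: quadratic_irrational_def)
  then obtain D where "root_of_discriminant D x (a, b, c)"
    by (simp add: root_of_discriminant_def)
  hence "\<exists>t. root_of_discriminant D (complete_quotient x n) t" for n
    using root_of_discriminant_complete_quotient irr by blast
  then obtain f where f: "\<And>n. root_of_discriminant D (complete_quotient x n) (f n)"
    by metis
  obtain N where N: "\<And>n. n \<ge> N \<Longrightarrow> reduced (complete_quotient x n)"
    using eventually_reduced[OF assms(1) irr] by blast
  have coeffs: "fst (f n) * snd (snd (f n)) < 0" if "n \<ge> N" for n
    using outer_coeffs_opposite_signs[OF complete_quotient_K[OF assms(1)]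
        complete_quotient_irrational[OF irr], of n D "fst (f n)" "fst (snd (f n))" "snd (snd (f n))"]
      f[of n] N[OF that] by (simp add: reduced_def)
  have "f ` {N..} \<subseteq> {-D..D} \<times> {-D..D} \<times> {-D..D}"
  proof (rule image_subsetI)
    fix n assume n: "n \<in> {N..}"
    obtain a b c where t: "f n = (a, b, c)" by (cases "f n")
    have "a * c < 0" using coeffs[of n] n t by simp
    moreover have "b\<^sup>2 - 4 * a * c = D" using f[of n] t by (simp add: root_of_discriminant_def)
    ultimately show "f n \<in> {-D..D} \<times> {-D..D} \<times> {-D..D}"
      unfolding t using coeffs_bounded by blast
  qed
  hence "finite (f ` {N..})" by (rule finite_subset) blast
  hence "\<not> inj_on f {N..}" using finite_imageD infinite_Ici by blast
  then obtain i j where ij: "i \<ge> N" "j \<ge> N" "i < j" "f i = f j"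
    unfolding inj_on_def by (metis atLeast_iff linorder_neqE_nat)
  have "complete_quotient x i = complete_quotient x j"
    using positive_root_unique[of D _ "fst (f i)" "fst (snd (f i))" "snd (snd (f i))"]
      f[of i] f[of j] ij coeffs[of i] N[of i] N[of j] by (simp add: reduced_def)
  hence "complete_quotient (complete_quotient x i) (j - i) = complete_quotient x i"
    using ij(3) by (metis complete_quotient_add le_add_diff_inverse less_imp_le)
  thus ?thesis using that[of "j - i" i] ij(3) by simp
qed

section \<open>Reversing a period\<close>

text \<open>In a purely periodic expansion each complete quotient reappears with arbitrarily large index,
where it has to be reduced.\<close>

lemma purely_periodic_reduced:
  assumes "y \<in> K" "y \<notin> \<rat>" "k > 0" "complete_quotient y k = y"
  shows "reduced (complete_quotient y i)"
proof -
  obtain N where N: "\<And>n. n \<ge> N \<Longrightarrow> reduced (complete_quotient y n)"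
    using eventually_reduced[OF assms(1,2)] by blast
  have "complete_quotient y (j * k) = y" for j
    by (induction j) (simp_all add: complete_quotient_add assms(4))
  hence "complete_quotient y i = complete_quotient y (N * k + i)"
    by (simp add: complete_quotient_add)
  moreover have "N * k + i \<ge> N" using assms(3) by (simp add: trans_le_add1)
  ultimately show ?thesis using N by simp
qed

text \<open>Galois' theorem on reversed periods. Conjugating \<open>y = b + 1/y1\<close> and putting \<open>z = -1/y'\<close>,
\<open>z1 = -1/y1'\<close> gives \<open>z1 = b + 1/z\<close>: the numbers \<open>z\<close> belonging to the complete quotients of
\<open>y\<close> satisfy the same recursion backwards. Reducedness, \<open>z > 1\<close>, makes this recursion a step
of the continued fraction algorithm.\<close>

lemma cf_expansion_uminus_inverse_conjugate:
  assumes "y \<in> K" "y \<notin> \<rat>" "bs \<noteq> []" "cf_expansion y = cycle bs"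
  shows "cf_expansion (- 1 / conjugate y) = cycle (rev bs)"
proof -
  define k where "k = length bs"
  have k: "k > 0" using assms(3) by (simp add: k_def)
  have "cf_expansion (complete_quotient y k) = cf_expansion y"
    using assms(3,4) by (simp add: sdrop_cf_expansion[symmetric] k_def)
  hence per: "complete_quotient y k = y"
    using eq_if_cf_expansion_eq complete_quotient_irrational assms(2) by blast
  have bs: "bs = map (\<lambda>i. \<lfloor>complete_quotient y i\<rfloor>) [0..<k]"
    using stake_cf_expansion[of k y] assms(3,4) by (simp add: k_def)
  define z where "z = (\<lambda>i. - 1 / conjugate (complete_quotient y i))"
  have neg: "-1 < conjugate (complete_quotient y i)" "conjugate (complete_quotient y i) < 0" for i
    using purely_periodic_reduced[OF assms(1,2) k per, of i] by (auto simp: reduced_def)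
  have z1: "z i > 1" for i using neg[of i] by (simp add: z_def field_simps)
  have zi: "conjugate (complete_quotient y i) = - 1 / z i" for i by (simp add: z_def)
  have zSuc: "z (Suc i) = \<lfloor>complete_quotient y i\<rfloor> + 1 / z i" for i
    using conjugate_complete_quotient_decomp[OF assms(1,2), of i] unfolding zi by simp
  have fl: "\<lfloor>z (Suc i)\<rfloor> = \<lfloor>complete_quotient y i\<rfloor>" and st: "cf_step (z (Suc i)) = z i" for i
    using cf_step_eqI[OF zSuc z1] by blast+
  have cq: "j \<le> k \<Longrightarrow> complete_quotient (z k) j = z (k - j)" for j
  proof (induction j)
    case (Suc j)
    hence "complete_quotient (z k) (Suc j) = cf_step (z (Suc (k - Suc j)))"
      by (simp add: complete_quotient_Suc Suc_diff_Suc)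
    thus ?case by (simp add: st)
  qed simp
  have z0k: "z k = z 0" by (simp add: z_def per)
  have "map (\<lambda>j. \<lfloor>complete_quotient (z k) j\<rfloor>) [0..<k] = rev bs"
  proof (rule nth_equalityI)
    fix j assume "j < length (map (\<lambda>j. \<lfloor>complete_quotient (z k) j\<rfloor>) [0..<k])"
    hence j: "j < k" by simp
    have "\<lfloor>complete_quotient (z k) j\<rfloor> = \<lfloor>z (Suc (k - Suc j))\<rfloor>"
      using cq[of j] j by (simp add: Suc_diff_Suc)
    thus "map (\<lambda>j. \<lfloor>complete_quotient (z k) j\<rfloor>) [0..<k] ! j = rev bs ! j"
      using j by (simp add: bs rev_nth fl)
  qed (simp add: k_def)
  moreover have "cf_expansion (z k) = cycle (map (\<lambda>j. \<lfloor>complete_quotient (z k) j\<rfloor>) [0..<k])"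
    using cq[of k] z0k k by (intro cf_expansion_eq_cycleI) simp_all
  ultimately show ?thesis using z0k by (simp add: z_def)
qed

end

lemma has_cf_periodE:
  assumes "has_cf_period x bs"
  obtains n where "cf_expansion (complete_quotient x n) = cycle bs"
proof -
  obtain as where "cf_expansion x = as @- cycle bs"
    using assms by (auto simp: has_cf_period_def)
  hence "cf_expansion (complete_quotient x (length as)) = cycle bs"
    by (simp add: sdrop_cf_expansion[symmetric] sdrop_shift)
  thus ?thesis by (rule that)
qed

text \<open>A common tail of \<open>x\<close> and \<open>z\<close> may start in the middle of a period \<open>bs\<close> of \<open>z\<close>. Passing to
a later tail, whose index \<open>j + e\<close> in \<open>z\<close> is a multiple of the length of \<open>bs\<close>, restores the
period itself.\<close>

lemma has_cf_period_if_tail_equiv: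
  assumes "tail_equiv x z" "cf_expansion z = cycle bs" "bs \<noteq> []"
  shows "has_cf_period x bs"
proof -
  obtain i j where ij: "complete_quotient x i = complete_quotient z j"
    using assms(1) unfolding tail_equiv_def by blast
  \<comment> \<open>chosen so that \<open>j + e = j * length bs\<close>\<close>
  define e where "e = j * (length bs - 1)"
  have "j + e = j * length bs"
    using assms(3) unfolding e_def by (cases "length bs") auto
  hence "sdrop (j + e) (cycle bs) = cycle bs" using assms(3) by simp
  moreover have "sdrop (i + e) (cf_expansion x) = sdrop (j + e) (cf_expansion z)"
    by (simp add: sdrop_cf_expansion complete_quotient_add ij)
  ultimately have "cf_expansion x = stake (i + e) (cf_expansion x) @- cycle bs"
    using stake_sdrop[of "i + e" "cf_expansion x"] assms(2) by simp
  thus ?thesis unfolding has_cf_period_def using assms(3) by blast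
qed

text \<open>Let \<open>y\<close> be a complete quotient of \<open>x\<close> with the purely periodic expansion given by \<open>bs\<close>, and
\<open>w = -1/y'\<close>, whose expansion is given by the reverse of \<open>bs\<close>. Always \<open>w\<close> is equivalent to
\<open>y'\<close> and thus to \<open>x'\<close>. If the reverse of \<open>bs\<close> is a period of \<open>x\<close>, then \<open>w\<close> is itself a
complete quotient of \<open>x\<close>, hence equivalent to \<open>x\<close>. Conversely, if \<open>x'\<close> and \<open>x\<close> are
equivalent, then so are \<open>w\<close> and \<open>x\<close>, and the expansions of \<open>w\<close> and \<open>x\<close> have a common tail.\<close>

lemma (in real_quadratic_field) self_inverse_period_iff_moebius_equiv_conjugate:
  assumes "x \<in> K" "quadratic_irrational x"
  shows "self_inverse_period x \<longleftrightarrow> moebius_equiv (conjugate x) x"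
proof
  have irr: "x \<notin> \<rat>" using assms(2) by (simp add: quadratic_irrational_def)
  assume "self_inverse_period x"
  then obtain bs where bs: "has_cf_period x bs" "has_cf_period x (rev bs)"
    unfolding self_inverse_period_def by blast
  obtain n m where n: "cf_expansion (complete_quotient x n) = cycle bs"
    and m: "cf_expansion (complete_quotient x m) = cycle (rev bs)"
    using bs has_cf_periodE by metis
  define y where "y = complete_quotient x n"
  define z where "z = complete_quotient x m"
  have y: "y \<in> K" "y \<notin> \<rat>" and z: "z \<in> K" "z \<notin> \<rat>"
    using assms(1) irr complete_quotient_K complete_quotient_irrational by (auto simp: y_def z_def)
  have yc: "conjugate y \<notin> \<rat>" using conjugate_irrational(1)[OF y] .
  have irr': "- 1 / conjugate y \<notin> \<rat>" using inverse_irrational[OF yc] by simp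
  have "cf_expansion (- 1 / conjugate y) = cf_expansion z"
    using cf_expansion_uminus_inverse_conjugate[OF y] n m bs(1)
    by (simp add: y_def z_def has_cf_period_def)
  hence zy: "z = - 1 / conjugate y" using eq_if_cf_expansion_eq[OF irr' z(2)] by simp
  have "moebius_equiv (conjugate x) (conjugate y)"
    using moebius_equiv_conjugate[OF moebius_equiv_complete_quotient[OF irr]] y by (simp add: y_def)
  also have "moebius_equiv (conjugate y) z"
  proof -
    have "conjugate y \<noteq> 0" using yc by auto
    thus ?thesis unfolding zy by (rule moebius_equiv_sym[OF moebius_equiv_uminus_inverse])
  qed
  also have "moebius_equiv z x"
    unfolding z_def by (rule moebius_equiv_sym[OF moebius_equiv_complete_quotient[OF irr]])
  finally show "moebius_equiv (conjugate x) x" .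
next
  have irr: "x \<notin> \<rat>" using assms(2) by (simp add: quadratic_irrational_def)
  assume equiv: "moebius_equiv (conjugate x) x"
  obtain n k where k: "k > 0" and
    per: "complete_quotient (complete_quotient x n) k = complete_quotient x n"
    using complete_quotients_periodic[OF assms] by blast
  define y where "y = complete_quotient x n"
  have y: "y \<in> K" "y \<notin> \<rat>"
    using assms(1) irr complete_quotient_K complete_quotient_irrational by (auto simp: y_def)
  define bs where "bs = map (\<lambda>i. \<lfloor>complete_quotient y i\<rfloor>) [0..<k]"
  have bs: "bs \<noteq> []" using k by (simp add: bs_def)
  have cy: "cf_expansion y = cycle bs"
    unfolding bs_def using per k by (intro cf_expansion_eq_cycleI) (simp_all add: y_def)
  hence cz: "cf_expansion (- 1 / conjugate y) = cycle (rev bs)"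
    using cf_expansion_uminus_inverse_conjugate[OF y bs] by blast
  have "tail_equiv x y"
    unfolding tail_equiv_def y_def by (intro exI[of _ n] exI[of _ 0]) simp
  hence 1: "has_cf_period x bs" using cy bs by (rule has_cf_period_if_tail_equiv)
  have yc: "conjugate y \<noteq> 0" using conjugate_irrational(1)[OF y] by auto
  have "moebius_equiv (- 1 / conjugate y) (conjugate y)"
    using yc by (rule moebius_equiv_uminus_inverse)
  also have "moebius_equiv (conjugate y) (conjugate x)"
    using moebius_equiv_conjugate[OF moebius_equiv_sym[OF moebius_equiv_complete_quotient[OF irr]]]
      assms(1) by (simp add: y_def)
  also note equiv
  finally have "tail_equiv (- 1 / conjugate y) x" using irr by (rule tail_equiv_if_moebius_equiv)
  hence "has_cf_period x (rev bs)"
    using has_cf_period_if_tail_equiv[OF tail_equiv_sym cz] bs by simp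
  with 1 show "self_inverse_period x" unfolding self_inverse_period_def using assms(2) by blast
qed

section \<open>Pell equations\<close>

text \<open>The correspondence between matrices and solutions is \<open>a = -d\<close>, lower left entry \<open>q * c\<close>,
\<open>r = d + c * m\<close> and \<open>b = m * k - c * q * v\<close> with \<open>2 * r - c * m = q * k\<close>.\<close>

lemma (in real_quadratic_field) moebius_equiv_conjugate_iff_pell:
  fixes v q m :: int
  assumes "s\<^sup>2 = of_int v" "q > 0" "coprime m q"
  shows "moebius_equiv (m / q - s) (m / q + s) \<longleftrightarrow>
    (\<exists>r c :: int. r\<^sup>2 - (q * c)\<^sup>2 * v \<in> {1, -1} \<and> q dvd 2 * r - c * m)"
proof
  assume "moebius_equiv (m / q - s) (m / q + s)"
  then obtain a b c d :: int where det: "\<bar>a * d - b * c\<bar> = 1"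
    and nz: "c * (m / q + s) + d \<noteq> 0"
    and eq: "m / q - s = (a * (m / q + s) + b) / (c * (m / q + s) + d)"
    unfolding moebius_equiv_def by blast
  have q0: "real_of_int q \<noteq> 0" using assms(2) by simp
  define f :: real where "f = m / q"
  have mf: "of_int m = f * of_int q" using q0 by (simp add: f_def)
  have eq': "(f - s) * (c * (f + s) + d) = a * (f + s) + b"
    using eq nz by (simp add: f_def)
  have s2: "s * s = of_int v" using assms(1) by (simp add: power2_eq_square)
  have "(c * (f * f - v) + d * f) + (- real_of_int d) * s = (a * f + b) + a * s"
    using eq' s2 by algebra
  moreover have "f \<in> \<rat>" by (simp add: f_def)
  ultimately have 1: "c * (f * f - v) + d * f = a * f + b" and 2: "- real_of_int d = a"
    using coords_unique[of "c * (f * f - v) + d * f" "- d" "a * f + b" a] by simp_all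
  have a: "a = - d" using 2 by linarith
  have "real_of_int (c * (m\<^sup>2 - q\<^sup>2 * v) + 2 * d * m * q)
      = (c * (f * f - v) + 2 * d * f) * (real_of_int q)\<^sup>2"
    by (simp add: mf) (simp add: algebra_simps power2_eq_square)
  also have "c * (f * f - v) + 2 * d * f = b" using 1 a by (simp add: algebra_simps)
  also have "b * (real_of_int q)\<^sup>2 = real_of_int (b * q\<^sup>2)" by simp
  finally have b: "c * (m\<^sup>2 - q\<^sup>2 * v) + 2 * d * m * q = b * q\<^sup>2" by (simp only: of_int_eq_iff)
  define \<epsilon> where "\<epsilon> = - (a * d - b * c)"
  have \<epsilon>: "\<epsilon> \<in> {1, -1}" using det by (auto simp: \<epsilon>_def)
  have norm: "(q * d + c * m)\<^sup>2 = q\<^sup>2 * (\<epsilon> + c\<^sup>2 * v)"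
    using b unfolding \<epsilon>_def a by algebra
  \<comment> \<open>\<open>(q * d + c * m) / q\<close> is rational with an integral square, hence an integer\<close>
  hence "q\<^sup>2 dvd (q * d + c * m)\<^sup>2" by simp
  hence "q dvd q * d + c * m" by simp
  hence "q dvd c * m" by (metis dvd_add_right_iff dvd_triv_left)
  hence "q dvd c" using assms(3) by (simp add: coprime_commute coprime_dvd_mult_left_iff)
  then obtain c' where c: "c = q * c'" by (rule dvdE)
  define r where "r = d + c' * m"
  have "q * d + c * m = q * r" by (simp add: c r_def algebra_simps)
  hence "q\<^sup>2 * r\<^sup>2 = q\<^sup>2 * (\<epsilon> + c\<^sup>2 * v)" using norm by (simp add: power_mult_distrib)
  hence "r\<^sup>2 - (q * c')\<^sup>2 * v = \<epsilon>" using assms(2) c by simp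
  moreover have "q * (m * (2 * r - c' * m)) = q * (q * (b + c' * q * v))"
    using b unfolding c r_def by algebra
  hence "m * (2 * r - c' * m) = q * (b + c' * q * v)" using assms(2) by simp
  hence "q dvd 2 * r - c' * m"
    using assms(3) by (metis coprime_commute coprime_dvd_mult_right_iff dvd_triv_left)
  ultimately show "\<exists>r c :: int. r\<^sup>2 - (q * c)\<^sup>2 * v \<in> {1, -1} \<and> q dvd 2 * r - c * m"
    using \<epsilon> by metis
next
  assume "\<exists>r c :: int. r\<^sup>2 - (q * c)\<^sup>2 * v \<in> {1, -1} \<and> q dvd 2 * r - c * m"
  then obtain r c k :: int where pell: "r\<^sup>2 - (q * c)\<^sup>2 * v \<in> {1, -1}"
    and k: "2 * r - c * m = q * k"
    unfolding dvd_def by blast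
  define d where "d = r - c * m"
  define b where "b = m * k - c * q * v"
  define f :: real where "f = m / q"
  have mf: "of_int m = f * of_int q" using assms(2) by (simp add: f_def)
  have s2: "s * s = of_int v" using assms(1) by (simp add: power2_eq_square)
  have det: "(- d) * d - b * (q * c) = - (r\<^sup>2 - (q * c)\<^sup>2 * v)"
    using k unfolding d_def b_def by algebra
  have kr: "2 * real_of_int r - real_of_int c * real_of_int m = real_of_int q * real_of_int k"
    using k by (metis of_int_diff of_int_mult of_int_numeral)
  have dr: "real_of_int d = real_of_int r - real_of_int c * real_of_int m"
    and br: "real_of_int b = real_of_int m * real_of_int k
      - real_of_int c * real_of_int q * real_of_int v"
    by (simp_all add: d_def b_def)
  have eq: "(f - s) * (real_of_int q * real_of_int c * (f + s) + real_of_int d)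
      = (- real_of_int d) * (f + s) + real_of_int b"
    using kr dr br mf s2 by algebra
  have "f + s \<notin> \<rat>"
    using s_irrational by (metis Rats_diff Rats_divide Rats_of_int add_diff_cancel_left' f_def)
  have nz: "of_int (q * c) * (f + s) + of_int d \<noteq> 0"
  proof
    assume "of_int (q * c) * (f + s) + of_int d = 0"
    hence "(of_int d + of_int (q * c) * f) + of_int (q * c) * s = 0 + 0 * s"
      by (simp add: algebra_simps)
    hence qc: "of_int (q * c) = (0::real)" and d: "of_int d + of_int (q * c) * f = 0"
      using coords_unique[of "of_int d + of_int (q * c) * f" "of_int (q * c)" 0 0]
      by (auto simp: f_def)
    have "d = 0" using d unfolding qc by simp
    moreover have "q * c = 0" using qc by (simp only: of_int_eq_0_iff)
    ultimately have "r\<^sup>2 - (q * c)\<^sup>2 * v = 0" using det by algebra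
    thus False using pell by simp
  qed
  have "f - s = (of_int (- d) * (f + s) + of_int b) / (of_int (q * c) * (f + s) + of_int d)"
    using eq nz by (simp add: field_simps)
  moreover have "\<bar>(- d) * d - b * (q * c)\<bar> = 1" unfolding det using pell by auto
  ultimately show "moebius_equiv (m / q - s) (m / q + s)"
    unfolding moebius_equiv_def f_def[symmetric] using nz by blast
qed

text \<open>\<open>R\<close> and \<open>c * e\<close> are the coordinates of \<open>(r + c sqrt v) ^ Suc n\<close>. Expanding the power modulo
\<open>c\<close> leaves \<open>r ^ Suc n\<close> in the first coordinate, and in the second, after division by \<open>c\<close>,
the single term \<open>(n + 1) * r ^ n\<close>.\<close>

lemma pell_power:
  fixes r c v :: int
  shows "\<exists>R e. R\<^sup>2 - (c * e)\<^sup>2 * v = (r\<^sup>2 - c\<^sup>2 * v) ^ Suc n \<and>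
    c dvd R - r ^ Suc n \<and> c dvd e - (int n + 1) * r ^ n"
proof (induction n)
  case 0
  show ?case by (intro exI[of _ r] exI[of _ 1]) simp
next
  case (Suc n)
  then obtain R e where pell: "R\<^sup>2 - (c * e)\<^sup>2 * v = (r\<^sup>2 - c\<^sup>2 * v) ^ Suc n"
    and R: "c dvd R - r ^ Suc n" and e: "c dvd e - (int n + 1) * r ^ n"
    by blast
  define R' where "R' = r * R + c * (c * e * v)"
  define e' where "e' = r * e + R"
  have "R'\<^sup>2 - (c * e')\<^sup>2 * v = (r\<^sup>2 - c\<^sup>2 * v) * (R\<^sup>2 - (c * e)\<^sup>2 * v)"
    unfolding R'_def e'_def by algebra
  hence "R'\<^sup>2 - (c * e')\<^sup>2 * v = (r\<^sup>2 - c\<^sup>2 * v) ^ Suc (Suc n)" using pell by simp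
  moreover have "R' - r ^ Suc (Suc n) = r * (R - r ^ Suc n) + c * (c * e * v)"
    by (simp add: R'_def algebra_simps)
  hence "c dvd R' - r ^ Suc (Suc n)" using R by simp
  moreover have "e' - (int (Suc n) + 1) * r ^ Suc n
      = r * (e - (int n + 1) * r ^ n) + (R - r ^ Suc n)"
    by (simp add: e'_def algebra_simps)
  hence "c dvd e' - (int (Suc n) + 1) * r ^ Suc n" using R e by simp
  ultimately show ?case by blast
qed

text \<open>By \<open>pell_power\<close> the congruence for the power with exponent \<open>n + 1\<close> reads
\<open>r ^ n * (2 * r - (n + 1) * c * m) = 0\<close> modulo \<open>q\<close>. The linear congruence
\<open>(n + 1) * c * m = 2 * r\<close> modulo \<open>q\<close> has a solution \<open>n\<close> because
\<open>gcd (c * m) q = gcd c q\<close> divides \<open>2\<close>.\<close>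

lemma pell_congruence_solvable:
  fixes v q m r c :: int
  assumes "q > 0" "coprime m q" "gcd c q dvd 2"
    and pell: "r\<^sup>2 - (q * c)\<^sup>2 * v \<in> {1, -1}"
  shows "\<exists>R C :: int. R\<^sup>2 - (q * C)\<^sup>2 * v \<in> {1, -1} \<and> q dvd 2 * R - C * m"
proof -
  have "gcd (c * m) q = gcd c q"
    using assms(2) by (simp add: gcd_mult_right_right_cancel gcd.commute coprime_commute)
  hence "gcd (c * m) q dvd 2 * r" using assms(3) by simp
  moreover obtain u w where "u * (c * m) + w * q = gcd (c * m) q" using bezout_int by blast
  ultimately obtain l where "2 * r = (u * (c * m) + w * q) * l" by (metis dvdE)
  hence t: "2 * r - (u * l) * (c * m) = q * (w * l)" by algebra
  \<comment> \<open>\<open>u * l\<close> solves the linear congruence; the exponent \<open>n + 1\<close> is its least positive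
    representative\<close>
  define n where "n = nat ((u * l - 1) mod q)"
  have "int n = (u * l - 1) mod q" using assms(1) by (simp add: n_def)
  hence "q dvd (u * l - 1) - int n" by (simp add: minus_mod_eq_mult_div)
  then obtain h where h: "u * l - 1 - int n = q * h" by (rule dvdE)
  have n: "2 * r - (int n + 1) * (c * m) = q * (w * l + h * (c * m))"
    using t h by algebra
  obtain R e where norm: "R\<^sup>2 - (q * c * e)\<^sup>2 * v = (r\<^sup>2 - (q * c)\<^sup>2 * v) ^ Suc n"
    and R: "q * c dvd R - r ^ Suc n" and e: "q * c dvd e - (int n + 1) * r ^ n"
    using pell_power[of "q * c" v r n] by blast
  obtain R' where R': "R = r ^ Suc n + q * c * R'"
    using R by (metis dvdE diff_add_cancel add.commute)
  obtain e' where e': "e = (int n + 1) * r ^ n + q * c * e'"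
    using e by (metis dvdE diff_add_cancel add.commute)
  have "2 * R - (c * e) * m = r ^ n * (2 * r - (int n + 1) * (c * m))
      + q * (2 * c * R' - c * (c * e') * m)"
    unfolding R' e' by (simp add: algebra_simps)
  hence "2 * R - (c * e) * m = q * (r ^ n * (w * l + h * (c * m)) + (2 * c * R' - c * (c * e') * m))"
    unfolding n by (simp add: algebra_simps)
  hence "q dvd 2 * R - (c * e) * m" by simp
  moreover have "(r\<^sup>2 - (q * c)\<^sup>2 * v) ^ Suc n \<in> {1, -1}"
    using pell by (metis insertE insertI1 insert_iff minus_one_power_iff power_one singletonD)
  hence "R\<^sup>2 - (q * (c * e))\<^sup>2 * v \<in> {1, -1}" using norm by (simp add: mult.assoc)
  ultimately show ?thesis by blast
qed

text \<open>A common divisor of \<open>c\<close> and \<open>q\<close> divides \<open>2 * r\<close> by the congruence and is coprime to \<open>r\<close> by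
the Pell equation, so it divides \<open>2\<close>. If \<open>q\<close> is even, then \<open>m\<close> is odd and the congruence
makes \<open>c\<close> even.\<close>

lemma gcd_of_pell_congruence:
  fixes v q m r c :: int
  assumes "coprime m q" "q dvd 2 * r - c * m"
    and pell: "r\<^sup>2 - (q * c)\<^sup>2 * v \<in> {1, -1}"
  shows "gcd c q = (if even q then 2 else 1)"
proof -
  define g where "g = gcd c q"
  have g: "g dvd c" "g dvd q" "g \<ge> 0" by (simp_all add: g_def)
  have "g dvd 2 * r - c * m" using g(2) assms(2) by (rule dvd_trans)
  hence "g dvd 2 * r" using g(1) dvd_add[of g "2 * r - c * m" "c * m"] by simp
  moreover have "coprime g r"
  proof (rule coprimeI)
    fix h assume h: "h dvd g" "h dvd r"
    have "h dvd q * c" using h(1) g(1) by (meson dvd_mult dvd_trans)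
    hence "h dvd r\<^sup>2 - (q * c)\<^sup>2 * v" using h(2) by (simp add: power2_eq_square)
    thus "h dvd 1" using pell by auto
  qed
  ultimately have g2: "g dvd 2" by (simp add: coprime_dvd_mult_left_iff)
  show ?thesis
  proof (cases "even q")
    case True
    hence "odd m" using assms(1) by (metis coprime_common_divisor odd_one)
    moreover have "even (2 * r - c * m)" using True assms(2) by (rule dvd_trans)
    ultimately have "even c" by simp
    hence "2 dvd g" using True by (simp add: g_def)
    hence "g = 2" using g2 g(3) by (simp add: zdvd_antisym_nonneg)
    thus ?thesis using True by (simp add: g_def)
  next
    case False
    hence "odd g" using g(2) dvd_trans by blast
    hence "coprime g 2" by simp
    hence "is_unit g" using g2 by (metis coprime_common_divisor dvd_refl)
    hence "g = 1" using g(3) by auto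
    thus ?thesis using False by (simp add: g_def)
  qed
qed

lemma pell_congruence_iff_gcd:
  fixes v q m :: int
  assumes "q > 0" "coprime m q"
  shows "(\<exists>r c :: int. r\<^sup>2 - (q * c)\<^sup>2 * v \<in> {1, -1} \<and> q dvd 2 * r - c * m) \<longleftrightarrow>
    (\<exists>r c :: int. r\<^sup>2 - c\<^sup>2 * v \<in> {1, -1} \<and> gcd c (q\<^sup>2) = q * (if even q then 2 else 1))"
proof
  assume "\<exists>r c :: int. r\<^sup>2 - (q * c)\<^sup>2 * v \<in> {1, -1} \<and> q dvd 2 * r - c * m"
  then obtain r c where rc: "r\<^sup>2 - (q * c)\<^sup>2 * v \<in> {1, -1}" "q dvd 2 * r - c * m" by blast
  have "gcd (q * c) (q\<^sup>2) = q * gcd c q"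
    using assms(1) by (simp add: power2_eq_square gcd_mult_left)
  also have "gcd c q = (if even q then 2 else 1)"
    using gcd_of_pell_congruence assms(2) rc by blast
  finally show "\<exists>r c :: int. r\<^sup>2 - c\<^sup>2 * v \<in> {1, -1} \<and> gcd c (q\<^sup>2) = q * (if even q then 2 else 1)"
    using rc(1) by blast
next
  assume "\<exists>r c :: int. r\<^sup>2 - c\<^sup>2 * v \<in> {1, -1} \<and> gcd c (q\<^sup>2) = q * (if even q then 2 else 1)"
  then obtain r c where pell: "r\<^sup>2 - c\<^sup>2 * v \<in> {1, -1}"
    and g: "gcd c (q\<^sup>2) = q * (if even q then 2 else 1)" by blast
  have "q dvd c" using g by (metis dvd_trans dvd_triv_left gcd_dvd1)
  then obtain c' where c: "c = q * c'" by (rule dvdE)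
  have "q * gcd c' q = q * (if even q then 2 else 1)"
    using g assms(1) unfolding c by (simp add: power2_eq_square gcd_mult_left)
  hence "gcd c' q = (if even q then 2 else 1)" using assms(1) by (simp only: mult_cancel_left) simp
  hence "gcd c' q dvd 2" by simp
  thus "\<exists>r c :: int. r\<^sup>2 - (q * c)\<^sup>2 * v \<in> {1, -1} \<and> q dvd 2 * r - c * m"
    using pell_congruence_solvable[OF assms] pell c by blast
qed

lemma sqrt_int_irrational:
  fixes v :: int
  assumes "v > 0" "\<not> (\<exists>k::int. v = k\<^sup>2)"
  shows "sqrt (of_int v) \<notin> \<rat>"
proof
  assume "sqrt (of_int v) \<in> \<rat>"
  then obtain a b where b0: "b > 0" and ab: "sqrt (of_int v) = of_int a / of_int b"
    by (rule Rats_cases')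
  have b: "b \<noteq> 0" using b0 by simp
  have "real_of_int v = (a / b)\<^sup>2"
    unfolding ab[symmetric] using assms(1) by simp
  hence "real_of_int (v * b\<^sup>2) = real_of_int (a\<^sup>2)" using b by (simp add: field_simps)
  hence eq: "v * b\<^sup>2 = a\<^sup>2" by (simp only: of_int_eq_iff)
  hence "b\<^sup>2 dvd a\<^sup>2" by (metis dvd_triv_right)
  hence "b dvd a" by simp
  then obtain k where "a = b * k" by (rule dvdE)
  hence "v = k\<^sup>2" using eq b by (simp add: power_mult_distrib)
  thus False using assms(2) by blast
qed

theorem corollary2:
  fixes v q m q1' :: int and x :: real
  assumes "v > 0" and "q > 0"
    and "\<not> (\<exists>k::int. v = k\<^sup>2)"
    and "gcd m q = 1"
    and "x = of_int m / of_int q + sqrt (of_int v)"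
    and "q1' = (if even q then 2 else 1)"
  shows "self_inverse_period x \<longleftrightarrow>
    (\<exists>r c :: int. r\<^sup>2 - c\<^sup>2 * v \<in> {1, -1} \<and> gcd c (q\<^sup>2) = q * q1')"
proof -
  define s where "s = sqrt (of_int v)"
  have s: "s \<notin> \<rat>" "s\<^sup>2 = of_int v"
    using sqrt_int_irrational[OF assms(1,3)] assms(1) by (simp_all add: s_def)
  interpret real_quadratic_field s
    by unfold_locales (use s in auto)
  have x: "x = of_int m / of_int q + 1 * s" by (simp add: assms(5) s_def)
  have xK: "x \<in> K" unfolding x by (intro K_I) auto
  have conj_x: "conjugate x = of_int m / of_int q - s"
    unfolding x by (subst conjugate_eq) auto
  have "x \<notin> \<rat>"
  proof
    assume "x \<in> \<rat>"
    hence "x - of_int m / of_int q \<in> \<rat>" by simp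
    thus False using s(1) x by simp
  qed
  moreover have "of_int (q\<^sup>2) * x\<^sup>2 + of_int (- 2 * m * q) * x + of_int (m\<^sup>2 - q\<^sup>2 * v) = 0"
  proof -
    have "of_int q * x - of_int m = of_int q * s" using assms(2) by (simp add: x field_simps)
    hence "(of_int q * x - of_int m)\<^sup>2 = (of_int q)\<^sup>2 * of_int v"
      using s(2) by (simp add: power_mult_distrib)
    thus ?thesis by (simp add: algebra_simps power2_eq_square)
  qed
  ultimately have "quadratic_irrational x"
    unfolding quadratic_irrational_def using assms(2) by (metis power_not_zero less_irrefl)
  hence "self_inverse_period x \<longleftrightarrow> moebius_equiv (m / q - s) (m / q + s)"
    using self_inverse_period_iff_moebius_equiv_conjugate[OF xK] conj_x x by simp
  also have "\<dots> \<longleftrightarrow>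
      (\<exists>r c :: int. r\<^sup>2 - (q * c)\<^sup>2 * v \<in> {1, -1} \<and> q dvd 2 * r - c * m)"
    using moebius_equiv_conjugate_iff_pell s(2) assms(2,4) by (simp add: coprime_iff_gcd_eq_1)
  also have "\<dots> \<longleftrightarrow>
      (\<exists>r c :: int. r\<^sup>2 - c\<^sup>2 * v \<in> {1, -1} \<and> gcd c (q\<^sup>2) = q * q1')"
    unfolding assms(6) using pell_congruence_iff_gcd assms(2,4)
    by (simp add: coprime_iff_gcd_eq_1)
  finally show ?thesis .
qed

end
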